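(* A linear finite difference operator $T$ with constant coefficients of the form $$T(p(x))=a_0p(x)+a_1p(x-1)+\cdots+a_kp(x-k)$$ is a discrete hyperbolicity preserver if and only if all zeros of its symbol polynomial $Q(t)=a_0+a_1t+\cdots+a_kt^k$ are real and non-negative.
   Context: Linear finite difference operators here act on $\mathbb{C}[x]$ and have the form $T(p)(x)=q_0(x)p(x)+q_1(x)p(x-1)+\cdots+q_k(x)p(x-k)$, where $q_0(x),\ldots,q_k(x)$ are fixed complex- or real-valued polynomials; in the constant coefficient case these are constants $a_0,\ldots,a_k$. $\mathcal{HP}\subset\mathbb{R}[x]$ denotes the set of all real-rooted (also called hyperbolic) polynomials. For $p\in\mathcal{HP}$, $\operatorname{mesh}(p)$ is the minimal distance between its roots; if $p$ has a multiple root, then $\operatorname{mesh}(p):=0$; polynomials of degree at most $1$ are defined to have mesh equal to $+\infty$. $\mathcal{HP}_{\ge 1}\subset\mathcal{HP}$ denotes the set of all real-rooted polynomials whose mesh is at least $1$. A linear finite difference operator is called a discrete hyperbolicity preserver if it preserves $\mathcal{HP}_{\ge 1}$.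
   Formalization: The symbol Q is assumed not to be the zero polynomial, and the "if" direction is stated only for real coefficients a_0,…,a_k (it fails for k=0, a_0=i); the "only if" direction is stated for complex coefficients as well. *)

theory Defs
  imports Complex_Main "HOL-Computational_Algebra.Polynomial" "HOL-Library.Extended_Real"
begin

definition fd_operator :: "nat \<Rightarrow> (nat \<Rightarrow> complex poly) \<Rightarrow> complex poly \<Rightarrow> complex poly" where
  "fd_operator k q p = (\<Sum>i\<le>k. q i * pcompose p [:- of_nat i, 1:])"

definition const_fd_operator :: "nat \<Rightarrow> (nat \<Rightarrow> complex) \<Rightarrow> complex poly \<Rightarrow> complex poly" where
  "const_fd_operator k a = fd_operator k (\<lambda>i. [:a i:])"

definition symbol_poly :: "nat \<Rightarrow> (nat \<Rightarrow> complex) \<Rightarrow> complex poly" where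
  "symbol_poly k a = (\<Sum>i\<le>k. monom (a i) i)"

abbreviation complexify :: "real poly \<Rightarrow> complex poly" where
  "complexify \<equiv> map_poly complex_of_real"

(* The zero polynomial counts as hyperbolic.  Otherwise not even the backward difference
   p(x) - p(x - 1), which annihilates constants, would preserve hyperbolicity. *)
definition HP :: "real poly set" where
  "HP = {p. p = 0 \<or> (\<forall>z. poly (complexify p) z = 0 \<longrightarrow> z \<in> \<real>)}"

(* Only used for members of HP.  For these the infimum in the last case ranges over a finite
   nonempty set of distances, so it is a minimum. *)
definition mesh :: "real poly \<Rightarrow> ereal" where
  "mesh p =
     (if degree p \<le> 1 then \<infinity>
      else if \<exists>x. order x p \<ge> 2 then 0
      else Inf {ereal \<bar>x - y\<bar> | x y. poly p x = 0 \<and> poly p y = 0 \<and> x \<noteq> y})"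

definition HP_ge1 :: "real poly set" where
  "HP_ge1 = {p \<in> HP. mesh p \<ge> 1}"

(* Operators act on complex polynomials, while HP_ge1 consists of real ones; real polynomials
   are identified with their images under complexify. *)
definition discrete_hyperbolicity_preserver :: "(complex poly \<Rightarrow> complex poly) \<Rightarrow> bool" where
  "discrete_hyperbolicity_preserver T \<longleftrightarrow>
     T ` complexify ` HP_ge1 \<subseteq> complexify ` HP_ge1"

end

theory Submission
  imports Defs "HOL-Computational_Algebra.Fundamental_Theorem_Algebra"
begin

text \<open>
  Write \<open>S\<close> for the shift \<open>p(x) \<mapsto> p(x - 1)\<close>, so that the operator is \<open>Q(S)\<close>.

  \<^bold>\<open>Non-negative zeros suffice.\<close> \<open>Q(S)\<close> is a product of a constant and factors \<open>S - r\<close> with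
  \<open>r \<ge> 0\<close>, so one factor is enough (lemma \<open>HP_ge1_backshift_minus\<close>). Let \<open>p\<close> have roots
  \<open>x\<^sub>1 < \<dots> < x\<^sub>n\<close> with gaps at least \<open>1\<close> and put \<open>g(x) = p(x - 1) - r p(x)\<close>. The roots
  \<open>x\<^sub>i + 1\<close> of \<open>p(x - 1)\<close> interlace weakly with those of \<open>p\<close>, and \<open>g\<close> takes values
  \<open>- r p(x\<^sub>i + 1)\<close> and \<open>p(x\<^sub>i\<^sub>+\<^sub>1 - 1)\<close> at the ends of \<open>[x\<^sub>i + 1, x\<^sub>i\<^sub>+\<^sub>1]\<close>. Both arguments
  of \<open>p\<close> lie between \<open>x\<^sub>i\<close> and \<open>x\<^sub>i\<^sub>+\<^sub>1\<close>, where \<open>p\<close> keeps its sign, so \<open>g\<close> has a root in that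
  interval. Consecutive intervals are at distance \<open>1\<close>, whence the spacing of these \<open>n - 1\<close>
  roots comes for free. If \<open>r = 1\<close>, the degree of \<open>g\<close> is at most \<open>n - 1\<close>; otherwise the
  behaviour at infinity gives one more root, beyond \<open>x\<^sub>n + 1\<close> or before \<open>x\<^sub>1\<close>.

  \<^bold>\<open>Other zeros are harmful.\<close> Apply the operator to the falling factorial
  \<open>p\<^sub>n(x) = x(x - 1)\<dots>(x - n + 1)\<close>. For \<open>n \<ge> k\<close> the result is
  \<open>R\<^sub>n(x) (x - k)\<dots>(x - n + 1)\<close> with \<open>degree R\<^sub>n \<le> k\<close>. If the operator is a preserver, every
  root of \<open>R\<^sub>n\<close> is real, and by the mesh condition none lies in \<open>[k, n)\<close>, since it would be
  within distance less than \<open>1\<close> of one of the roots \<open>k, \<dots>, n - 1\<close>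
  (lemma \<open>falling_quotient_root_gap\<close>). Rescaling, \<open>R\<^sub>n(n s) / n\<^sup>k\<close> tends to
  \<open>F(s) = s\<^sup>k Q((s - 1) / s)\<close>. A zero \<open>t\<close> of \<open>Q\<close> becomes the zero \<open>u = 1 / (1 - t)\<close> of \<open>F\<close>,
  and \<open>t\<close> fails to be real and non-negative precisely when \<open>u\<close> is non-real or in the interval
  \<open>(0, 1)\<close> (the value \<open>t = 1\<close> corresponds to infinity). In that case a fixed disc about \<open>u\<close>
  contains no root of \<open>R\<^sub>n(n s)\<close> for large \<open>n\<close>. A polynomial of degree at most \<open>k\<close> without roots
  near \<open>u\<close> is bounded everywhere by a multiple of its modulus at \<open>u\<close>, with a factor that does
  not depend on the polynomial (lemma \<open>poly_growth_away_from_roots\<close>). In the limit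
  \<open>F(u) = 0\<close> forces \<open>F = 0\<close>, hence \<open>Q = 0\<close>. This takes the place of Hurwitz's theorem.
\<close>

section \<open>Real polynomials inside the complex ones\<close>

lemma complexify_pCons [simp]: "complexify (pCons c p) = pCons (of_real c) (complexify p)"
  by (simp add: map_poly_pCons)

lemma complexify_add [simp]: "complexify (p + q) = complexify p + complexify q"
  by (simp add: poly_eq_iff coeff_map_poly)

lemma complexify_smult [simp]: "complexify (smult c p) = smult (of_real c) (complexify p)"
  by (simp add: poly_eq_iff coeff_map_poly)

lemma complexify_mult [simp]: "complexify (p * q) = complexify p * complexify q"
  by (simp add: poly_eq_iff coeff_map_poly coeff_mult)

lemma complexify_sum: "complexify (\<Sum>i\<in>A. f i) = (\<Sum>i\<in>A. complexify (f i))"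
  by (induction A rule: infinite_finite_induct) simp_all

lemma complexify_prod: "complexify (\<Prod>i\<in>A. f i) = (\<Prod>i\<in>A. complexify (f i))"
  by (induction A rule: infinite_finite_induct) simp_all

lemma complexify_pcompose: "complexify (pcompose p q) = pcompose (complexify p) (complexify q)"
  by (induction p) (simp_all add: pcompose_pCons)

lemma poly_complexify_of_real [simp]: "poly (complexify p) (of_real x) = of_real (poly p x)"
  by (induction p) simp_all

lemma complexify_eq_iff [simp]: "complexify p = complexify q \<longleftrightarrow> p = q"
  by (simp add: poly_eq_iff coeff_map_poly)

lemma degree_complexify [simp]: "degree (complexify p) = degree p"
  by (simp add: degree_map_poly)

lemma complexify_eq_0_iff [simp]: "complexify p = 0 \<longleftrightarrow> p = 0"
  using complexify_eq_iff [of p 0] by simp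

section \<open>Polynomials with spaced roots\<close>

definition spaced :: "real set \<Rightarrow> bool" where
  "spaced X \<longleftrightarrow> finite X \<and> (\<forall>x\<in>X. \<forall>y\<in>X. x \<noteq> y \<longrightarrow> \<bar>x - y\<bar> \<ge> 1)"

definition root_poly :: "'a::comm_ring_1 set \<Rightarrow> 'a poly" where
  "root_poly X = (\<Prod>x\<in>X. [:- x, 1:])"

lemma poly_root_poly: "poly (root_poly X) z = (\<Prod>x\<in>X. z - x)"
  by (simp add: root_poly_def poly_prod)

lemma poly_root_poly_eq_0_iff:
  fixes X :: "'a::idom set"
  assumes "finite X"
  shows "poly (root_poly X) z = 0 \<longleftrightarrow> z \<in> X"
  using assms by (auto simp: poly_root_poly)

lemma root_poly_insert:
  assumes "finite X" "x \<notin> X"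
  shows "root_poly (insert x X) = [:- x, 1:] * root_poly X"
  using assms by (simp add: root_poly_def)

lemma lead_coeff_root_poly [simp]:
  fixes X :: "'a::idom set"
  shows "lead_coeff (root_poly X) = 1"
  unfolding root_poly_def by (simp add: lead_coeff_prod)

lemma root_poly_nonzero [simp]:
  fixes X :: "'a::idom set"
  shows "root_poly X \<noteq> 0"
  using lead_coeff_root_poly [of X] by force

lemma degree_root_poly [simp]:
  fixes X :: "'a::idom set"
  shows "degree (root_poly X) = card X"
  unfolding root_poly_def by (subst degree_prod_sum_eq) auto

lemma root_poly_dvd:
  fixes g :: "'a::idom poly"
  assumes "finite Y" and "\<And>y. y \<in> Y \<Longrightarrow> poly g y = 0"
  shows "root_poly Y dvd g"
  using assms
proof (induction Y arbitrary: g rule: finite_induct)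
  case empty
  show ?case by (simp add: root_poly_def)
next
  case (insert y Y)
  from insert.prems have "[:- y, 1:] dvd g"
    by (simp add: poly_eq_0_iff_dvd)
  then obtain h where h: "g = [:- y, 1:] * h" ..
  have "poly h z = 0" if "z \<in> Y" for z
    using insert.prems [of z] insert.hyps that by (auto simp: h)
  then show ?case
    using insert.IH [of h] insert.hyps h
    by (metis mult_dvd_mono dvd_refl root_poly_insert)
qed

lemma HP_ge1_root_poly:
  assumes "spaced X"
  shows "smult c (root_poly X) \<in> HP_ge1"
proof (cases "c = 0")
  case True
  then show ?thesis by (simp add: HP_ge1_def HP_def mesh_def)
next
  case False
  let ?h = "smult c (root_poly X)"
  have fin: "finite X" and gap: "\<And>x y. x \<in> X \<Longrightarrow> y \<in> X \<Longrightarrow> x \<noteq> y \<Longrightarrow> \<bar>x - y\<bar> \<ge> 1"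
    using assms by (auto simp: spaced_def)
  have root: "x \<in> X" if "poly ?h x = 0" for x
    using that False fin by (simp add: poly_root_poly_eq_0_iff)
  have "?h \<in> HP"
    using False fin by (auto simp: HP_def root_poly_def complexify_prod poly_prod)
  moreover have "\<not> order x ?h \<ge> 2" for x
  proof
    assume "order x ?h \<ge> 2"
    then have "[:- x, 1:] ^ 2 dvd ?h"
      by (simp add: order_divides)
    then have dvd: "[:- x, 1:] * [:- x, 1:] dvd root_poly X"
      using False by (simp add: dvd_smult_iff power2_eq_square)
    then have "poly (root_poly X) x = 0"
      using dvd_mult_left poly_eq_0_iff_dvd by blast
    then have "x \<in> X" using fin by (simp add: poly_root_poly_eq_0_iff)
    then have "root_poly X = [:- x, 1:] * root_poly (X - {x})"
      using root_poly_insert [of "X - {x}" x] fin by (simp add: insert_absorb)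
    with dvd have "[:- x, 1:] dvd root_poly (X - {x})"
      by (metis dvd_mult_cancel_left one_neq_zero pCons_eq_0_iff)
    then show False
      using fin by (simp add: poly_eq_0_iff_dvd [symmetric] poly_root_poly_eq_0_iff)
  qed
  moreover have "1 \<le> Inf {ereal \<bar>x - y\<bar> | x y. poly ?h x = 0 \<and> poly ?h y = 0 \<and> x \<noteq> y}"
    by (rule Inf_greatest) (use root gap in \<open>auto simp: one_ereal_def\<close>)
  ultimately show ?thesis
    by (auto simp: HP_ge1_def mesh_def)
qed

text \<open>A double root is treated as a pair of roots at distance \<open>0\<close>, so that simplicity of the
  roots and their spacing become one condition, which passes to divisors. This makes the
  induction in \<open>HP_ge1_E\<close> possible.\<close>

lemma HP_ge1_two_roots:
  assumes "h \<in> HP_ge1" "h \<noteq> 0" and dvd: "[:- x, 1:] * [:- y, 1:] dvd h"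
  shows "\<bar>x - y\<bar> \<ge> 1"
proof -
  have m: "mesh h \<ge> 1" using assms(1) by (simp add: HP_ge1_def)
  have "degree ([:- x, 1:] * [:- y, 1:]) \<le> degree h"
    using dvd assms(2) by (rule dvd_imp_degree_le)
  then have deg: "\<not> degree h \<le> 1" by (simp add: degree_mult_eq)
  then have simple: "\<not> order z h \<ge> 2" for z
    using m by (auto simp: mesh_def split: if_splits)
  show ?thesis
  proof (cases "x = y")
    case True
    then have "[:- x, 1:] ^ 2 dvd h"
      using dvd by (simp only: power2_eq_square)
    then show ?thesis
      using simple [of x] assms(2) by (simp only: order_divides) simp
  next
    case False
    have "poly h x = 0" "poly h y = 0"
      using dvd by (simp_all only: poly_eq_0_iff_dvd) (blast intro: dvd_mult_left dvd_mult_right)+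
    then have "Inf {ereal \<bar>x - y\<bar> | x y. poly h x = 0 \<and> poly h y = 0 \<and> x \<noteq> y} \<le> ereal \<bar>x - y\<bar>"
      using False by (intro Inf_lower) auto
    moreover have "mesh h = Inf {ereal \<bar>x - y\<bar> | x y. poly h x = 0 \<and> poly h y = 0 \<and> x \<noteq> y}"
      using deg simple by (auto simp: mesh_def)
    ultimately have "1 \<le> ereal \<bar>x - y\<bar>"
      using m by (metis order_trans)
    then show ?thesis by (simp add: one_ereal_def)
  qed
qed

text \<open>Splitting off linear factors one at a time serves twice: to write members of
  \<^const>\<open>HP_ge1\<close> as products, and to reduce a symbol to its linear factors.\<close>

lemma real_rooted_induct [consumes 2, case_names const linear]:
  fixes q :: "real poly"
  assumes "q \<noteq> 0" and real: "\<forall>z. poly (complexify q) z = 0 \<longrightarrow> z \<in> \<real>"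
    and const: "\<And>c. c \<noteq> 0 \<Longrightarrow> P [:c:]"
    and linear: "\<And>r q. q \<noteq> 0 \<Longrightarrow> \<forall>z. poly (complexify q) z = 0 \<longrightarrow> z \<in> \<real> \<Longrightarrow> P q
                   \<Longrightarrow> P ([:- r, 1:] * q)"
  shows "P q"
  using assms(1,2)
proof (induction "degree q" arbitrary: q)
  case 0
  then show ?case
    using const by (metis degree_eq_zeroE pCons_eq_0_iff)
next
  case (Suc n)
  have "degree (complexify q) \<noteq> 0"
    using Suc.hyps(2) by simp
  then obtain z where z: "poly (complexify q) z = 0"
    using fundamental_theorem_of_algebra_alt [of "complexify q"] by fastforce
  with Suc.prems obtain r where "z = of_real r"
    by (auto elim: Reals_cases)
  with z have "poly q r = 0" by simp
  then obtain q' where q: "q = [:- r, 1:] * q'"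
    by (auto simp only: poly_eq_0_iff_dvd elim: dvdE)
  have "q' \<noteq> 0" using q Suc.prems(1) by auto
  moreover have "n = degree q'"
    using Suc.hyps(2) \<open>q' \<noteq> 0\<close> by (simp add: q degree_mult_eq del: mult_pCons_left)
  moreover have "z \<in> \<real>" if "poly (complexify q') z = 0" for z
    using Suc.prems(2) that by (simp add: q del: mult_pCons_left)
  ultimately show ?case
    using Suc.hyps(1) linear unfolding q by blast
qed

text \<open>With \<open>HP_ge1_root_poly\<close> this replaces root multiplicities and the infimum in
  \<^const>\<open>mesh\<close> by a spaced set of roots and a constant factor.\<close>

lemma HP_ge1_E:
  assumes "h \<in> HP_ge1" "h \<noteq> 0"
  obtains c X where "spaced X" "h = smult c (root_poly X)"
proof -
  have "\<forall>z. poly (complexify h) z = 0 \<longrightarrow> z \<in> \<real>"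
    using assms by (auto simp: HP_ge1_def HP_def)
  from assms(2) this
  have "(\<forall>x y. [:- x, 1:] * [:- y, 1:] dvd h \<longrightarrow> 1 \<le> \<bar>x - y\<bar>) \<longrightarrow>
          (\<exists>c X. spaced X \<and> h = smult c (root_poly X))"
  proof (induction h rule: real_rooted_induct)
    case (const c)
    then show ?case
      by (intro impI exI [of _ c] exI [of _ "{}"]) (simp add: spaced_def root_poly_def)
  next
    case (linear r q)
    show ?case
    proof
      assume sep: "\<forall>x y. [:- x, 1:] * [:- y, 1:] dvd [:- r, 1:] * q \<longrightarrow> 1 \<le> \<bar>x - y\<bar>"
      have "1 \<le> \<bar>x - y\<bar>" if "[:- x, 1:] * [:- y, 1:] dvd q" for x y
        using sep that dvd_mult by blast
      with linear.IH obtain c X where X: "spaced X" "q = smult c (root_poly X)"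
        by blast
      have fin: "finite X" using X(1) by (simp add: spaced_def)
      have far: "\<bar>r - x\<bar> \<ge> 1" if "x \<in> X" for x
      proof (rule sep [rule_format])
        have "poly q x = 0" using that fin by (simp add: X(2) poly_root_poly_eq_0_iff)
        then have "[:- x, 1:] dvd q" by (simp only: poly_eq_0_iff_dvd)
        then show "[:- r, 1:] * [:- x, 1:] dvd [:- r, 1:] * q"
          by (rule mult_dvd_mono [OF dvd_refl])
      qed
      then have "r \<notin> X" by force
      then have "[:- r, 1:] * q = smult c (root_poly (insert r X))"
        using root_poly_insert [OF fin \<open>r \<notin> X\<close>] by (simp only: X(2) mult_smult_right)
      moreover have "spaced (insert r X)"
        using X(1) far by (auto simp: spaced_def abs_minus_commute)
      ultimately show "\<exists>c X. spaced X \<and> [:- r, 1:] * q = smult c (root_poly X)" by blast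
    qed
  qed
  then show ?thesis using that HP_ge1_two_roots [OF assms] by blast
qed

text \<open>A nonzero polynomial with as many roots as its degree allows has no others, all of them
  are simple, and it is a constant multiple of the product of its linear factors.\<close>

lemma HP_ge1_I:
  assumes "spaced Y" and "\<And>y. y \<in> Y \<Longrightarrow> poly g y = 0" and "degree g \<le> card Y"
  shows "g \<in> HP_ge1"
proof -
  have "root_poly Y dvd g"
    using assms by (intro root_poly_dvd) (auto simp: spaced_def)
  then obtain h where h: "g = root_poly Y * h" ..
  have "degree h = 0"
    using assms(3) by (cases "h = 0") (simp_all add: h degree_mult_eq)
  then obtain c where "h = [:c:]" by (auto elim: degree_eq_zeroE)
  then have "g = smult c (root_poly Y)" by (simp add: h)
  then show ?thesis using HP_ge1_root_poly [OF assms(1)] by simp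
qed

section \<open>One linear factor of the symbol\<close>

abbreviation backshift :: "real poly \<Rightarrow> real poly" where
  "backshift p \<equiv> pcompose p [:- 1, 1:]"

lemma poly_backshift [simp]: "poly (backshift p) x = poly p (x - 1)"
  by (simp add: poly_pcompose)

lemma poly_root_between:
  fixes g :: "real poly"
  assumes "u \<le> v" "poly g u * poly g v \<le> 0"
  obtains z where "u \<le> z" "z \<le> v" "poly g z = 0"
proof (cases "poly g u * poly g v = 0")
  case True
  then show ?thesis using that assms(1) by auto
next
  case False
  then have "u < v" "poly g u * poly g v < 0"
    using assms by (auto simp: order_le_less mult_less_0_iff)
  then show ?thesis using poly_IVT [of u v g] that [OF less_imp_le less_imp_le] by blast
qed

lemma poly_same_sign:
  fixes p :: "real poly"
  assumes "u \<le> v" "\<And>z. u < z \<Longrightarrow> z < v \<Longrightarrow> poly p z \<noteq> 0"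
  shows "poly p u * poly p v \<ge> 0"
proof (rule ccontr)
  assume "\<not> poly p u * poly p v \<ge> 0"
  then have "poly p u * poly p v < 0" by simp
  moreover from this have "u < v"
    using assms(1) by (cases "u = v") (auto simp: mult_less_0_iff)
  ultimately show False using poly_IVT [of u v p] assms(2) by blast
qed

text \<open>The interlacing argument: one root of \<open>g = p(x - 1) - r p(x)\<close> between \<open>x + 1\<close> and the
  successor of \<open>x\<close>, for each root \<open>x\<close> of \<open>p\<close> except the largest, and for \<open>r \<noteq> 1\<close> one more
  outside the range of these.\<close>

lemma HP_ge1_backshift_minus:
  assumes X: "spaced X" and r: "r \<ge> 0"
  shows "backshift (root_poly X) - smult r (root_poly X) \<in> HP_ge1"
proof (cases "X = {}")
  case True
  then have "backshift (root_poly X) - smult r (root_poly X) = smult (1 - r) (root_poly {})"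
    by (simp add: root_poly_def pcompose_1 one_pCons)
  moreover have "spaced {}" by (simp add: spaced_def)
  ultimately show ?thesis using HP_ge1_root_poly by metis
next
  case False
  define p where "p = root_poly X"
  define g where "g = backshift p - smult r p"
  define M where "M = Max X"
  define m where "m = Min X"
  have fin: "finite X" and gap: "\<And>x y. x \<in> X \<Longrightarrow> y \<in> X \<Longrightarrow> x < y \<Longrightarrow> x + 1 \<le> y"
    using X by (force simp: spaced_def)+
  have root: "poly p x = 0 \<longleftrightarrow> x \<in> X" for x
    using fin by (simp add: p_def poly_root_poly_eq_0_iff)
  have g: "poly g x = poly p (x - 1) - r * poly p x" for x
    by (simp add: g_def)
  have MX: "M \<in> X" and M: "\<And>x. x \<in> X \<Longrightarrow> x \<le> M"
    and mX: "m \<in> X" and m: "\<And>x. x \<in> X \<Longrightarrow> m \<le> x"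
    using fin False by (auto simp: M_def m_def)
  \<comment> \<open>the next larger element of \<open>X\<close>\<close>
  define s where "s x = Min {y \<in> X. x < y}" for x
  have s: "s x \<in> X" "x < s x" "\<And>y. y \<in> X \<Longrightarrow> x < y \<Longrightarrow> s x \<le> y" if "x \<in> X - {M}" for x
  proof -
    have "x < M" using that M by force
    then have "M \<in> {y \<in> X. x < y}" using MX by simp
    then have ne: "{y \<in> X. x < y} \<noteq> {}" by blast
    have f: "finite {y \<in> X. x < y}" using fin by simp
    have "s x \<in> {y \<in> X. x < y}"
      unfolding s_def using Min_in [OF f ne] .
    then show "s x \<in> X" "x < s x" by auto
    show "s x \<le> y" if "y \<in> X" "x < y" for y
      unfolding s_def using f that by simp
  qed
  have "\<exists>z. x + 1 \<le> z \<and> z \<le> s x \<and> poly g z = 0" if x: "x \<in> X - {M}" for x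
  proof -
    have le: "x + 1 \<le> s x" using gap s x by auto
    have nz: "poly p z \<noteq> 0" if "x < z" "z < s x" for z
      using s(3) [OF x, of z] that root by force
    have "poly p (x + 1) * poly p (s x - 1) \<ge> 0"
    proof (cases "x + 1 \<le> s x - 1")
      case True
      then show ?thesis using nz by (intro poly_same_sign) auto
    next
      case False
      then have "poly p (s x - 1) * poly p (x + 1) \<ge> 0"
        using nz le by (intro poly_same_sign) auto
      then show ?thesis by (simp add: mult.commute)
    qed
    \<comment> \<open>At each end of the interval one of the two terms of \<open>g\<close> vanishes.\<close>
    moreover have "poly g (x + 1) = - r * poly p (x + 1)" "poly g (s x) = poly p (s x - 1)"
      using root x s(1) [OF x] by (simp_all add: g)
    ultimately have "poly g (x + 1) * poly g (s x) \<le> 0"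
      using r by (simp add: mult.assoc)
    then show ?thesis using poly_root_between [OF le] by blast
  qed
  then obtain y where y: "x + 1 \<le> y x" "y x \<le> s x" "poly g (y x) = 0" if "x \<in> X - {M}" for x
    by metis
  define Y where "Y = y ` (X - {M})"
  have step: "y x + 1 \<le> y x'" if "x \<in> X - {M}" "x' \<in> X - {M}" "x < x'" for x x'
    using y(2) [OF that(1)] s(3) [OF that(1), of x'] y(1) [OF that(2)] that by auto
  have inj: "inj_on y (X - {M})"
    by (rule linorder_inj_onI') (use step in fastforce)
  have cardY: "card Y + 1 = card X"
    using card_image [OF inj] MX fin by (simp add: Y_def card_gt_0_iff False Suc_leI)
  \<comment> \<open>The intervals containing the new roots are themselves \<open>1\<close> apart.\<close>
  have Y_gap: "1 \<le> \<bar>y x - y x'\<bar>" if "x \<in> X - {M}" "x' \<in> X - {M}" "y x \<noteq> y x'" for x x'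
    using step [OF that(1,2)] step [OF that(2,1)] that(3) by (cases x x' rule: linorder_cases) auto
  have Y: "spaced Y"
    using fin Y_gap by (auto simp: spaced_def Y_def)
  have Yroot: "poly g z = 0" if "z \<in> Y" for z
    using that y(3) by (auto simp: Y_def)
  have Y_ge: "m + 1 \<le> z" if "z \<in> Y" for z
    using that y(1) m by (force simp: Y_def)
  have Y_le: "z \<le> M" if "z \<in> Y" for z
    using that y(2) s(1) M by (force simp: Y_def)
  have lead: "lead_coeff p = 1" and deg: "degree p = card X"
    unfolding p_def by (rule lead_coeff_root_poly degree_root_poly)+
  have deg_le: "degree g \<le> card X"
    unfolding g_def by (rule degree_diff_le) (simp_all add: deg degree_pcompose)
  have top: "coeff g (card X) = 1 - r"
    using lead lead_coeff_comp [of "[:- 1, 1:]" p] by (simp add: g_def deg degree_pcompose)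
  \<comment> \<open>For \<open>r = 1\<close> the degree drops and the roots found so far suffice.\<close>
  show ?thesis
  proof (cases "r = 1")
    case True
    have "degree g \<noteq> card X"
      using top cardY True by (metis add_is_0 leading_coeff_0_iff degree_0 one_neq_zero cancel_comm_monoid_add_class.diff_cancel)
    then have "degree g \<le> card Y" using deg_le cardY by simp
    then show ?thesis using HP_ge1_I [OF Y Yroot] by (simp add: g_def p_def)
  next
    case r1: False
    then have deg_g: "degree g = card X"
      using top deg_le by (simp add: le_degree order_antisym)
    then have lead_g: "lead_coeff g = 1 - r" using top by simp
    have "\<exists>z. poly g z = 0 \<and> (z \<le> m \<or> M + 1 \<le> z)"
    proof (cases "r < 1")
      case True
      have pos: "poly p (M + 1) > 0"
        unfolding p_def poly_root_poly by (rule prod_pos) (use M in force)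
      have "lead_coeff g > 0" using lead_g True by simp
      then obtain B where B: "\<forall>x\<ge>B. lead_coeff g \<le> poly g x"
        using poly_pinfty_gt_lc by blast
      have "0 < poly g (max B (M + 1))"
        using B \<open>lead_coeff g > 0\<close> by (meson less_le_trans max.cobounded1)
      moreover have "poly g (M + 1) \<le> 0"
        using r pos root [of M] MX by (simp add: g)
      ultimately have "poly g (M + 1) * poly g (max B (M + 1)) \<le> 0"
        by (simp add: mult_nonpos_nonneg)
      then show ?thesis using poly_root_between [of "M + 1" "max B (M + 1)" g] by force
    next
      case False
      \<comment> \<open>\<open>g * p\<close> has even degree, so it has the sign of its leading coefficient \<open>1 - r < 0\<close> near
        minus infinity too; the reflection \<open>f\<close> turns this into a statement about plus infinity.\<close>
      define f where "f = - pcompose (g * p) [:0, - 1:]"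
      have "g \<noteq> 0" using lead_g r1 by auto
      moreover have "p \<noteq> 0" by (simp add: p_def)
      ultimately have "degree (g * p) = card X + card X"
        by (simp add: degree_mult_eq deg deg_g)
      moreover have "lead_coeff (g * p) = 1 - r"
        by (simp only: lead_coeff_mult lead lead_g mult_1_right)
      moreover have "lead_coeff f = - (lead_coeff (g * p) * (- 1) ^ degree (g * p))"
        by (simp add: f_def lead_coeff_comp)
      ultimately have "lead_coeff f = r - 1"
        by (simp add: mult_2 [symmetric])
      then have "lead_coeff f > 0" using False r1 by simp
      then obtain B where B: "\<forall>x\<ge>B. lead_coeff f \<le> poly f x"
        using poly_pinfty_gt_lc by blast
      define b where "b = min (- B) (m - 1)"
      have "0 < poly f (- b)"
        using B \<open>lead_coeff f > 0\<close> by (force simp: b_def intro: less_le_trans)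
      then have neg: "poly g b * poly p b < 0"
        by (simp add: f_def poly_pcompose)
      have "poly p b * poly p (m - 1) \<ge> 0"
        by (rule poly_same_sign) (use m root in \<open>force simp: b_def\<close>)+
      with neg have "poly g b * poly p (m - 1) \<le> 0"
        by (auto simp: mult_le_0_iff zero_le_mult_iff mult_less_0_iff)
      then have "poly g b * poly g m \<le> 0"
        using root [of m] mX by (simp add: g)
      then show ?thesis using poly_root_between [of b m g] by (force simp: b_def)
    qed
    then obtain z where z: "poly g z = 0" "z \<le> m \<or> M + 1 \<le> z" by blast
    have far: "1 \<le> \<bar>z - x\<bar>" if "x \<in> Y" for x
      using Y_ge [OF that] Y_le [OF that] z(2) by linarith
    then have "z \<notin> Y" by force
    then have "degree g \<le> card (insert z Y)"
      using deg_le cardY Y by (simp add: spaced_def)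
    moreover have "spaced (insert z Y)"
      using Y far by (auto simp: spaced_def abs_minus_commute)
    ultimately have "g \<in> HP_ge1"
      using HP_ge1_I [of "insert z Y" g] Yroot z(1) by auto
    then show ?thesis by (simp add: g_def p_def)
  qed
qed

section \<open>Symbols with non-negative zeros\<close>

lemma HP_ge1_smult:
  assumes "p \<in> HP_ge1"
  shows "smult c p \<in> HP_ge1"
proof (cases "p = 0")
  case False
  then show ?thesis
    using HP_ge1_E [OF assms] HP_ge1_root_poly by (metis smult_smult)
qed (use assms in simp)

text \<open>The operator with real symbol \<open>q\<close>. Indexing it by the polynomial, not by a coefficient
  sequence, lets it be taken apart along a factorisation of \<open>q\<close>.\<close>

definition fd_apply :: "real poly \<Rightarrow> real poly \<Rightarrow> real poly" where
  "fd_apply q p = (\<Sum>i\<le>degree q. smult (coeff q i) (pcompose p [:- of_nat i, 1:]))"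

lemma fd_apply_bound:
  assumes "degree q \<le> N"
  shows "fd_apply q p = (\<Sum>i\<le>N. smult (coeff q i) (pcompose p [:- of_nat i, 1:]))"
  unfolding fd_apply_def using assms
  by (intro sum.mono_neutral_left) (auto simp: coeff_eq_0)

text \<open>Multiplying the symbol by \<open>t - r\<close> composes the operator with \<open>S - r\<close>, because \<open>S\<close> turns
  the shift by \<open>i\<close> into the shift by \<open>i + 1\<close>.\<close>

lemma fd_apply_linear_factor:
  "fd_apply ([:- r, 1:] * q) p = backshift (fd_apply q p) - smult r (fd_apply q p)"
proof -
  let ?N = "degree q"
  let ?S = "\<lambda>i. pcompose p [:- of_nat i, 1:]"
  have deg: "degree ([:- r, 1:] * q) \<le> Suc ?N"
    by (rule order_trans [OF degree_mult_le]) simp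
  have "fd_apply ([:- r, 1:] * q) p
      = (\<Sum>i\<le>Suc ?N. smult (coeff (pCons 0 q) i) (?S i)) - (\<Sum>i\<le>Suc ?N. smult (r * coeff q i) (?S i))"
    unfolding fd_apply_bound [OF deg]
    by (simp add: smult_diff_left smult_add_left sum_subtractf [symmetric] del: sum.atMost_Suc)
  also have "(\<Sum>i\<le>Suc ?N. smult (r * coeff q i) (?S i)) = smult r (fd_apply q p)"
    unfolding fd_apply_bound [of q "Suc ?N", OF le_SucI [OF order_refl]]
    by (simp add: poly_eq_iff coeff_sum sum_distrib_left distrib_left mult.assoc)
  also have "(\<Sum>i\<le>Suc ?N. smult (coeff (pCons 0 q) i) (?S i)) = (\<Sum>i\<le>?N. smult (coeff q i) (?S (Suc i)))"
    by (subst sum.atMost_Suc_shift) simp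
  also have "\<dots> = backshift (fd_apply q p)"
    unfolding fd_apply_def pcompose_sum pcompose_smult
    by (intro sum.cong refl) (simp add: pcompose_assoc [symmetric] pcompose_pCons minus_diff_commute)
  finally show ?thesis .
qed

lemma HP_ge1_fd_apply:
  assumes "q \<noteq> 0"
    and "\<forall>z. poly (complexify q) z = 0 \<longrightarrow> z \<in> \<real>"
    and "\<And>r. poly q r = 0 \<Longrightarrow> r \<ge> 0"
    and p: "p \<in> HP_ge1"
  shows "fd_apply q p \<in> HP_ge1"
proof -
  have "(\<forall>r. poly q r = 0 \<longrightarrow> r \<ge> 0) \<longrightarrow> fd_apply q p \<in> HP_ge1"
    using assms(1,2)
  proof (induction q rule: real_rooted_induct)
    case (const c)
    then show ?case using p by (simp add: fd_apply_def HP_ge1_smult)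
  next
    case (linear r q)
    show ?case
    proof
      assume nonneg: "\<forall>z. poly ([:- r, 1:] * q) z = 0 \<longrightarrow> z \<ge> 0"
      have "r \<ge> 0" using nonneg by simp
      let ?h = "fd_apply q p"
      have "?h \<in> HP_ge1" using linear.IH nonneg by simp
      then have "backshift ?h - smult r ?h \<in> HP_ge1"
      proof (cases "?h = 0")
        case False
        with \<open>?h \<in> HP_ge1\<close> obtain c X where X: "spaced X" "?h = smult c (root_poly X)"
          by (rule HP_ge1_E)
        have "backshift ?h - smult r ?h
            = smult c (backshift (root_poly X) - smult r (root_poly X))"
          by (simp add: X(2) pcompose_smult smult_diff_right mult.commute)
        then show ?thesis
          using HP_ge1_smult [OF HP_ge1_backshift_minus [OF X(1) \<open>r \<ge> 0\<close>]] by simp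
      qed simp
      then show "fd_apply ([:- r, 1:] * q) p \<in> HP_ge1"
        by (simp only: fd_apply_linear_factor)
    qed
  qed
  then show ?thesis using assms(3) by blast
qed

section \<open>Evaluating the operator and its symbol\<close>

lemma poly_const_fd_operator:
  "poly (const_fd_operator k a p) z = (\<Sum>i\<le>k. a i * poly p (z - of_nat i))"
  by (simp add: const_fd_operator_def fd_operator_def poly_sum poly_pcompose)

lemma poly_symbol_poly: "poly (symbol_poly k a) t = (\<Sum>i\<le>k. a i * t ^ i)"
  by (simp add: symbol_poly_def poly_sum poly_monom)

lemma spaced_of_nat: "finite A \<Longrightarrow> spaced (real ` A)"
  by (auto simp: spaced_def abs_if)

section \<open>Operators applied to falling factorials\<close>

text \<open>For a linear polynomial \<open>x - z\<close> with \<open>\<bar>u - z\<bar> \<ge> d\<close> the triangle inequality gives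
  \<open>\<bar>v - z\<bar> \<le> \<bar>u - z\<bar> (1 + \<bar>v - u\<bar> / d)\<close>; the general case multiplies these bounds over the
  linear factors. The point is that the factor on the right depends on the degree of the
  polynomial only, so the bound survives limits.\<close>

lemma poly_growth_away_from_roots:
  fixes G :: "complex poly"
  assumes "d > 0" and "\<And>z. poly G z = 0 \<Longrightarrow> d \<le> norm (z - u)"
  shows "norm (poly G v) \<le> norm (poly G u) * (1 + norm (v - u) / d) ^ degree G"
  using assms(2)
proof (induction "degree G" arbitrary: G)
  case 0
  then obtain c where "G = [:c:]" using degree_eq_zeroE by metis
  then show ?case by simp
next
  case (Suc n)
  then obtain z where z: "poly G z = 0"
    using fundamental_theorem_of_algebra_alt [of G] by fastforce
  then obtain H where G: "G = [:- z, 1:] * H"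
    by (auto simp only: poly_eq_0_iff_dvd elim: dvdE)
  have "H \<noteq> 0" using Suc.hyps(2) by (auto simp: G)
  then have deg: "degree G = Suc (degree H)"
    unfolding G by (subst degree_mult_eq) auto
  have ge: "d \<le> norm (u - z)" using Suc.prems [OF z] by (simp add: norm_minus_commute)
  have "norm (v - z) \<le> norm (u - z) + norm (v - u)"
    using norm_triangle_ineq [of "u - z" "v - u"] by simp
  also have "norm (v - u) \<le> norm (u - z) * (norm (v - u) / d)"
    using mult_right_mono [OF ge, of "norm (v - u)"] assms(1) by (simp add: field_simps)
  finally have lin: "norm (v - z) \<le> norm (u - z) * (1 + norm (v - u) / d)"
    by (simp add: distrib_left)
  have IH: "norm (poly H v) \<le> norm (poly H u) * (1 + norm (v - u) / d) ^ degree H"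
    using Suc.hyps deg Suc.prems by (simp add: G)
  have "norm (poly G v) = norm (v - z) * norm (poly H v)"
    by (simp add: G algebra_simps flip: norm_mult)
  also have "\<dots> \<le> norm (u - z) * (1 + norm (v - u) / d)
                  * (norm (poly H u) * (1 + norm (v - u) / d) ^ degree H)"
    using lin IH assms(1) by (intro mult_mono) auto
  also have "\<dots> = norm ((u - z) * poly H u) * (1 + norm (v - u) / d) ^ degree G"
    by (simp add: deg norm_mult)
  also have "(u - z) * poly H u = poly G u"
    by (simp add: G algebra_simps)
  finally show ?case .
qed

text \<open>What remains of the image of \<open>x(x - 1)\<dots>(x - n + 1)\<close> after division by the factors
  \<open>x - k, \<dots>, x - n + 1\<close> common to all \<open>k + 1\<close> shifted copies.\<close>

definition falling_quotient :: "nat \<Rightarrow> (nat \<Rightarrow> complex) \<Rightarrow> nat \<Rightarrow> complex poly" where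
  "falling_quotient k a n =
     (\<Sum>i\<le>k. smult (a i) ((\<Prod>l<i. [:- of_nat (n + l), 1:]) * (\<Prod>l=i..<k. [:- of_nat l, 1:])))"

lemma poly_falling_quotient:
  "poly (falling_quotient k a n) z =
     (\<Sum>i\<le>k. a i * ((\<Prod>l<i. z - of_nat (n + l)) * (\<Prod>l=i..<k. z - of_nat l)))"
  by (simp add: falling_quotient_def poly_sum poly_prod algebra_simps)

lemma degree_falling_quotient: "degree (falling_quotient k a n) \<le> k"
  unfolding falling_quotient_def
proof (rule degree_sum_le)
  fix i assume "i \<in> {..k}"
  have "degree ((\<Prod>l<i. [:- of_nat (n + l), 1:]) * (\<Prod>l=i..<k. [:- of_nat l, 1::complex:]))
      = k"
    using \<open>i \<in> {..k}\<close>
    by (subst degree_mult_eq) (auto simp: degree_prod_sum_eq)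
  then show "degree (smult (a i) ((\<Prod>l<i. [:- of_nat (n + l), 1:]) * (\<Prod>l=i..<k. [:- of_nat l, 1:]))) \<le> k"
    by (metis degree_smult_le)
qed simp

lemma const_fd_operator_falling:
  assumes "k \<le> n"
  shows "const_fd_operator k a (root_poly (of_nat ` {..<n}))
       = falling_quotient k a n * root_poly (of_nat ` {k..<n})"
proof (subst poly_eq_poly_eq_iff [symmetric], rule ext)
  fix z :: complex
  have "(\<Prod>j<n. z - of_nat i - of_nat j) = (\<Prod>l<i. z - of_nat (n + l)) * (\<Prod>l=i..<k. z - of_nat l)
          * (\<Prod>j=k..<n. z - of_nat j)" if "i \<le> k" for i
  proof -
    let ?f = "\<lambda>j. z - of_nat j"
    have "(\<Prod>j<n. z - of_nat i - of_nat j) = (\<Prod>j=0..<n. ?f (j + i))"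
      by (simp add: lessThan_atLeast0 algebra_simps)
    also have "\<dots> = prod ?f {i..<n + i}"
      using prod.shift_bounds_nat_ivl [of ?f 0 i n] by simp
    also have "\<dots> = prod ?f {i..<k} * prod ?f {k..<n} * prod ?f {n..<n + i}"
      using that assms by (simp add: prod.atLeastLessThan_concat)
    also have "prod ?f {n..<n + i} = (\<Prod>l<i. ?f (n + l))"
      using prod.shift_bounds_nat_ivl [of ?f 0 n i] by (simp add: lessThan_atLeast0 add.commute)
    finally show ?thesis by (simp only: mult_ac)
  qed
  then show "poly (const_fd_operator k a (root_poly (of_nat ` {..<n}))) z
      = poly (falling_quotient k a n * root_poly (of_nat ` {k..<n})) z"
    by (simp add: poly_const_fd_operator poly_falling_quotient poly_root_poly prod.reindex
        sum_distrib_right mult.assoc)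
qed

text \<open>A root in \<open>[k, n)\<close> would be less than \<open>1\<close> away from its integer part, which is one of
  the roots \<open>k, \<dots>, n - 1\<close> split off. If the two coincide, the image has a double root.\<close>

lemma falling_quotient_root_gap:
  assumes pres: "discrete_hyperbolicity_preserver (const_fd_operator k a)"
    and kn: "k \<le> n" and nz: "falling_quotient k a n \<noteq> 0"
    and root: "poly (falling_quotient k a n) z = 0"
  obtains x where "z = of_real x" "x < real k \<or> real n \<le> x"
proof -
  let ?p = "root_poly (real ` {..<n})"
  have "?p \<in> HP_ge1" using HP_ge1_root_poly [OF spaced_of_nat, of "{..<n}" 1] by simp
  moreover have "complexify ?p = root_poly (of_nat ` {..<n})"
    by (simp add: root_poly_def complexify_prod prod.reindex)
  ultimately obtain h where h: "h \<in> HP_ge1"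
    "complexify h = falling_quotient k a n * root_poly (of_nat ` {k..<n})"
    using pres const_fd_operator_falling [OF kn, of a]
    by (force simp: discrete_hyperbolicity_preserver_def)
  have "h \<noteq> 0" using h(2) nz by auto
  have "poly (complexify h) z = 0" using root by (simp add: h(2))
  then have "z \<in> \<real>" using h(1) \<open>h \<noteq> 0\<close> by (auto simp: HP_ge1_def HP_def)
  then obtain x where x: "z = of_real x" by (auto elim: Reals_cases)
  have "x < real k \<or> real n \<le> x"
  proof (rule ccontr)
    assume "\<not> (x < real k \<or> real n \<le> x)"
    then have between: "real k \<le> x" "x < real n" by auto
    define j where "j = nat \<lfloor>x\<rfloor>"
    have j: "real j \<le> x" "x < real j + 1" "j \<in> {k..<n}"
      using between by (auto simp: j_def le_nat_floor, linarith+)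
    have "[:- z, 1:] dvd falling_quotient k a n"
      using root by (simp only: poly_eq_0_iff_dvd)
    moreover have "[:- of_nat j, 1:] dvd root_poly (of_nat ` {k..<n} :: complex set)"
      using j(3) unfolding root_poly_def by (intro dvd_prodI) auto
    ultimately have dvd: "[:- z, 1:] * [:- of_nat j, 1:] dvd complexify h"
      unfolding h(2) by (rule mult_dvd_mono)
    have "poly h x = 0"
      using \<open>poly (complexify h) z = 0\<close> by (simp add: x)
    then obtain h' where h': "h = [:- x, 1:] * h'"
      by (auto simp only: poly_eq_0_iff_dvd elim: dvdE)
    have "complexify h = [:- z, 1:] * complexify h'"
      unfolding h' x complexify_mult by simp
    with dvd have "[:- of_nat j, 1:] dvd complexify h'"
      by (metis dvd_mult_cancel_left one_neq_zero pCons_eq_0_iff)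
    then have "poly (complexify h') (of_real (real j)) = 0"
      by (simp only: poly_eq_0_iff_dvd of_real_of_nat_eq)
    then have "[:- real j, 1:] dvd h'"
      by (simp only: poly_complexify_of_real of_real_eq_0_iff poly_eq_0_iff_dvd)
    then have "[:- x, 1:] * [:- real j, 1:] dvd h"
      unfolding h' by (rule mult_dvd_mono [OF dvd_refl])
    then have "1 \<le> \<bar>x - real j\<bar>"
      by (rule HP_ge1_two_roots [OF h(1) \<open>h \<noteq> 0\<close>])
    then show False using j by simp
  qed
  with x show ?thesis using that by blast
qed

section \<open>The rescaled limit\<close>

text \<open>This is \<open>s\<^sup>k Q((s - 1) / s)\<close> cleared of denominators, a Moebius transform of the
  symbol \<open>Q\<close>.\<close>

definition limit_symbol :: "nat \<Rightarrow> (nat \<Rightarrow> complex) \<Rightarrow> complex \<Rightarrow> complex" where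
  "limit_symbol k a s = (\<Sum>i\<le>k. a i * ((s - 1) ^ i * s ^ (k - i)))"

lemma limit_symbol_eq:
  assumes "t \<noteq> 1"
  shows "limit_symbol k a (1 / (1 - t)) = (1 / (1 - t)) ^ k * poly (symbol_poly k a) t"
proof -
  define s where "s = 1 / (1 - t)"
  have s: "s - 1 = t * s" using assms by (simp add: s_def field_simps)
  have "a i * ((s - 1) ^ i * s ^ (k - i)) = s ^ k * (a i * t ^ i)" if "i \<le> k" for i
  proof -
    have "s ^ k = s ^ i * s ^ (k - i)" using that by (simp flip: power_add)
    then show ?thesis by (simp add: s power_mult_distrib)
  qed
  then show ?thesis
    unfolding limit_symbol_def poly_symbol_poly sum_distrib_left s_def [symmetric]
    by (intro sum.cong) auto
qed

lemma falling_quotient_tendsto: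
  "(\<lambda>n. poly (falling_quotient k a n) (of_nat n * s) / of_nat n ^ k) \<longlonglongrightarrow> limit_symbol k a s"
proof -
  have "(\<lambda>n. \<Sum>i\<le>k. a i * ((\<Prod>l<i. s - 1 - of_nat l / of_nat n) * (\<Prod>l=i..<k. s - of_nat l / of_nat n)))
      \<longlonglongrightarrow> (\<Sum>i\<le>k. a i * ((\<Prod>l<i. s - 1 - 0) * (\<Prod>l=i..<k. s - 0)))"
    by (intro tendsto_intros lim_const_over_n)
  then have lim: "(\<lambda>n. \<Sum>i\<le>k. a i * ((\<Prod>l<i. s - 1 - of_nat l / of_nat n) * (\<Prod>l=i..<k. s - of_nat l / of_nat n)))
      \<longlonglongrightarrow> limit_symbol k a s"
    by (simp add: limit_symbol_def)
  show ?thesis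
  proof (rule Lim_transform_eventually [OF lim])
    show "\<forall>\<^sub>F n in sequentially.
        (\<Sum>i\<le>k. a i * ((\<Prod>l<i. s - 1 - of_nat l / of_nat n) * (\<Prod>l=i..<k. s - of_nat l / of_nat n)))
        = poly (falling_quotient k a n) (of_nat n * s) / of_nat n ^ k"
      using eventually_gt_at_top [of 0]
    proof eventually_elim
      case (elim n)
      let ?n = "of_nat n :: complex"
      have n: "?n \<noteq> 0" using elim by simp
      have "(\<Prod>l<i. ?n * s - of_nat (n + l)) * (\<Prod>l=i..<k. ?n * s - of_nat l)
          = ?n ^ k * ((\<Prod>l<i. s - 1 - of_nat l / ?n) * (\<Prod>l=i..<k. s - of_nat l / ?n))"
        if "i \<le> k" for i
      proof -
        have "(\<Prod>l<i. ?n * s - of_nat (n + l)) = (\<Prod>l<i. ?n * (s - 1 - of_nat l / ?n))"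
          using n by (intro prod.cong) (simp_all add: field_simps)
        moreover have "(\<Prod>l=i..<k. ?n * s - of_nat l) = (\<Prod>l=i..<k. ?n * (s - of_nat l / ?n))"
          using n by (intro prod.cong) (simp_all add: field_simps)
        moreover have "?n ^ k = ?n ^ i * ?n ^ (k - i)" using that by (simp flip: power_add)
        ultimately show ?thesis by (simp add: prod.distrib)
      qed
      then show ?case
        using n by (simp add: poly_falling_quotient sum_divide_distrib)
    qed
  qed
qed

text \<open>The map \<open>t \<mapsto> 1 / (1 - t)\<close> preserves non-reality and sends the negative half-line to
  \<open>(0, 1)\<close>. Real points close to the image of a bad zero therefore lie in \<open>(0, 1)\<close>; the lower
  bound \<open>e\<close> keeps them away from \<open>0\<close>, so that \<open>n\<close> times such a point exceeds \<open>k\<close> for large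
  \<open>n\<close>.\<close>

lemma bad_zero_region:
  assumes "\<not> (t \<in> \<real> \<and> Re t \<ge> 0)"
  obtains d e where "d > 0" "e > 0"
    "\<And>x. norm (of_real x - 1 / (1 - t)) < d \<Longrightarrow> e < x \<and> x < 1"
proof (cases "t \<in> \<real>")
  case False
  have "1 / (1 - t) \<notin> \<real>"
  proof
    assume "1 / (1 - t) \<in> \<real>"
    then have "1 - inverse (1 / (1 - t)) \<in> \<real>"
      using Reals_diff Reals_inverse Reals_1 by blast
    then show False using False by simp
  qed
  then have "\<bar>Im (1 / (1 - t))\<bar> > 0" by (simp add: complex_is_Real_iff)
  moreover have "\<bar>Im (1 / (1 - t))\<bar> \<le> norm (of_real x - 1 / (1 - t))" for x
    using abs_Im_le_cmod [of "of_real x - 1 / (1 - t)"] by simp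
  ultimately show ?thesis using that [of "\<bar>Im (1 / (1 - t))\<bar>" 1] by (meson not_le zero_less_one)
next
  case True
  then obtain r where r: "t = of_real r" by (auto elim: Reals_cases)
  then have "r < 0" using assms by auto
  define c where "c = 1 / (1 - r)"
  have c: "0 < c" "c < 1" using \<open>r < 0\<close> by (auto simp: c_def)
  have "1 / (1 - t) = of_real c" by (simp add: r c_def)
  then have eq: "norm (of_real x - 1 / (1 - t)) = \<bar>x - c\<bar>" for x
    by (metis norm_of_real of_real_diff)
  show ?thesis
  proof (rule that [of "min (c / 2) (1 - c)" "c / 2"])
    show "c / 2 < x \<and> x < 1" if "norm (of_real x - 1 / (1 - t)) < min (c / 2) (1 - c)" for x
    proof -
      have "\<bar>x - c\<bar> < c / 2" "\<bar>x - c\<bar> < 1 - c" using that unfolding eq by simp_all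
      then show ?thesis by linarith
    qed
  qed (use c in auto)
qed

section \<open>The characterisation\<close>

lemma preserver_zeros_nonneg:
  assumes nz: "symbol_poly k a \<noteq> 0"
    and pres: "discrete_hyperbolicity_preserver (const_fd_operator k a)"
    and zero: "poly (symbol_poly k a) t = 0"
  shows "t \<in> \<real> \<and> Re t \<ge> 0"
proof (rule ccontr)
  assume bad: "\<not> (t \<in> \<real> \<and> Re t \<ge> 0)"
  then obtain d e where d: "d > 0" and e: "e > 0"
    and region: "\<And>x. norm (of_real x - 1 / (1 - t)) < d \<Longrightarrow> e < x \<and> x < 1"
    by (rule bad_zero_region) blast
  define u where "u = 1 / (1 - t)"
  have "t \<noteq> 1" using bad by auto
  then have Fu: "limit_symbol k a u = 0"
    by (simp add: u_def limit_symbol_eq zero)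
  let ?R = "falling_quotient k a"
  \<comment> \<open>The growth bound for the rescaled quotients, with a constant free of \<open>n\<close>, passes to the
    limit.\<close>
  have bound: "norm (limit_symbol k a s) \<le> norm (limit_symbol k a u) * (1 + norm (s - u) / d) ^ k" for s
  proof (rule LIMSEQ_le)
    show "(\<lambda>n. norm (poly (?R n) (of_nat n * s) / of_nat n ^ k)) \<longlonglongrightarrow> norm (limit_symbol k a s)"
      by (intro tendsto_norm falling_quotient_tendsto)
    show "(\<lambda>n. norm (poly (?R n) (of_nat n * u) / of_nat n ^ k) * (1 + norm (s - u) / d) ^ k)
        \<longlonglongrightarrow> norm (limit_symbol k a u) * (1 + norm (s - u) / d) ^ k"
      by (intro tendsto_mult tendsto_const tendsto_norm falling_quotient_tendsto)
    obtain N :: nat where N: "real k / e \<le> real N" using real_arch_simple by blast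
    show "\<exists>N. \<forall>n\<ge>N. norm (poly (?R n) (of_nat n * s) / of_nat n ^ k)
        \<le> norm (poly (?R n) (of_nat n * u) / of_nat n ^ k) * (1 + norm (s - u) / d) ^ k"
    proof (intro exI allI impI)
      fix n assume "n \<ge> Suc (max N k)"
      then have n: "n > 0" "k \<le> n" "N \<le> n" by auto
      then have "real k / e \<le> real n" using N by linarith
      then have ke: "real k \<le> e * real n" using e by (simp add: field_simps)
      let ?C = "1 + norm (s - u) / d"
      have C: "1 \<le> ?C" using d by simp
      have "norm (poly (?R n) (of_nat n * s)) \<le> norm (poly (?R n) (of_nat n * u)) * ?C ^ k"
      proof (cases "?R n = 0")
        case False
        have far: "real n * d \<le> norm (z - of_nat n * u)" if root: "poly (?R n) z = 0" for z
        proof (rule ccontr)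
          assume near: "\<not> real n * d \<le> norm (z - of_nat n * u)"
          obtain x where x: "z = of_real x" "x < real k \<or> real n \<le> x"
            using falling_quotient_root_gap [OF pres n(2) False root] .
          have "z - of_nat n * u = of_nat n * (of_real (x / real n) - u)"
            using n by (simp add: x field_simps)
          then have "norm (z - of_nat n * u) = real n * norm (of_real (x / real n) - u)"
            by (simp only: norm_mult norm_of_nat)
          with near n have "norm (of_real (x / real n) - u) < d" by simp
          then have "e < x / real n" "x / real n < 1"
            using region [of "x / real n"] by (auto simp: u_def)
          then have "real k \<le> x" "x < real n"
            using ke n by (auto simp: field_simps)
          with x(2) show False by simp
        qed
        have "norm (of_nat n * s - of_nat n * u) / (real n * d) = norm (s - u) / d"
          using n by (simp add: norm_mult flip: right_diff_distrib)
        then have "norm (poly (?R n) (of_nat n * s)) \<le> norm (poly (?R n) (of_nat n * u)) * ?C ^ degree (?R n)"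
          using poly_growth_away_from_roots [of "real n * d" "?R n" "of_nat n * u" "of_nat n * s"]
            far d n by simp
        also have "\<dots> \<le> norm (poly (?R n) (of_nat n * u)) * ?C ^ k"
          using C degree_falling_quotient by (intro mult_left_mono power_increasing) auto
        finally show ?thesis .
      qed simp
      then show "norm (poly (?R n) (of_nat n * s) / of_nat n ^ k)
        \<le> norm (poly (?R n) (of_nat n * u) / of_nat n ^ k) * ?C ^ k"
        using n by (simp add: norm_divide norm_power divide_right_mono)
    qed
  qed
  \<comment> \<open>The bound makes the limit vanish identically, while a point \<open>t1 \<noteq> 1\<close> that is not a zero of
    the symbol shows that it does not.\<close>
  have "symbol_poly k a * [:- 1, 1:] \<noteq> 0" using nz by (simp only: mult_eq_0_iff) simp
  then obtain t1 where "poly (symbol_poly k a * [:- 1, 1:]) t1 \<noteq> 0"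
    using poly_all_0_iff_0 by blast
  then have "t1 \<noteq> 1" "poly (symbol_poly k a) t1 \<noteq> 0" by auto
  then have "limit_symbol k a (1 / (1 - t1)) \<noteq> 0" by (simp add: limit_symbol_eq)
  moreover have "limit_symbol k a (1 / (1 - t1)) = 0"
    using bound [of "1 / (1 - t1)"] by (simp add: Fu)
  ultimately show False by simp
qed

lemma nonneg_zeros_preserver:
  assumes nz: "symbol_poly k a \<noteq> 0" and real: "\<forall>i\<le>k. a i \<in> \<real>"
    and zeros: "\<forall>t. poly (symbol_poly k a) t = 0 \<longrightarrow> t \<in> \<real> \<and> Re t \<ge> 0"
  shows "discrete_hyperbolicity_preserver (const_fd_operator k a)"
proof -
  define q where "q = (\<Sum>i\<le>k. monom (Re (a i)) i)"
  have a: "a i = of_real (Re (a i))" if "i \<le> k" for i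
    using real that by simp
  have coeff_q: "coeff q i = (if i \<le> k then Re (a i) else 0)" for i
    by (simp add: q_def coeff_sum if_distrib sum.delta cong: if_cong)
  have q: "complexify q = symbol_poly k a"
    using a by (auto simp: poly_eq_iff coeff_map_poly coeff_q symbol_poly_def coeff_sum)
  have deg: "degree q \<le> k" by (rule degree_le) (simp add: coeff_q)
  have T: "const_fd_operator k a (complexify p) = complexify (fd_apply q p)" for p
    using a by (simp add: const_fd_operator_def fd_operator_def fd_apply_bound [OF deg] coeff_q
        complexify_sum complexify_pcompose)
  have "fd_apply q p \<in> HP_ge1" if "p \<in> HP_ge1" for p
  proof (rule HP_ge1_fd_apply [OF _ _ _ that])
    show "q \<noteq> 0" using nz q by auto
    show "\<forall>z. poly (complexify q) z = 0 \<longrightarrow> z \<in> \<real>" using zeros by (simp add: q)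
    show "r \<ge> 0" if "poly q r = 0" for r
    proof -
      have "poly (symbol_poly k a) (of_real r) = 0" using that by (simp flip: q)
      then show ?thesis using zeros by force
    qed
  qed
  then show ?thesis by (auto simp: discrete_hyperbolicity_preserver_def T)
qed

theorem theorem3:
  fixes k :: nat and a :: "nat \<Rightarrow> complex"
  assumes "symbol_poly k a \<noteq> 0"
  shows "((\<forall>i\<le>k. a i \<in> \<real>) \<longrightarrow>
           (discrete_hyperbolicity_preserver (const_fd_operator k a) \<longleftrightarrow>
             (\<forall>t. poly (symbol_poly k a) t = 0 \<longrightarrow> t \<in> \<real> \<and> Re t \<ge> 0)))
       \<and> (discrete_hyperbolicity_preserver (const_fd_operator k a) \<longrightarrow>
             (\<forall>t. poly (symbol_poly k a) t = 0 \<longrightarrow> t \<in> \<real> \<and> Re t \<ge> 0))"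
  using preserver_zeros_nonneg [OF assms] nonneg_zeros_preserver [OF assms] by blast

end
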